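(* Let $(P,\le,{}',0,1)$ be a complemented poset satisfying the ACC and the DCC. Define $x|y:=\operatorname{Max}L(x',y')$ for $x,y\in P$, and for subsets $A,B\subseteq P$ put $A|B:=\operatorname{Max}L(A'\cup B')$, where $A':=\{a'\mid a\in A\}$ (elements identified with singletons; note $x|x=\{x'\}$). Then for all $x,y,z\in P$: (i) $x|y=y|x$; (ii) $(x|x)|(x|x)=x$; (iii) $(x|y)|(x|x)=x$; (iv) $\big(x'|(y'|z')'\big)'|z'=\big(x'|(y'|z')'\big)'|(x|x')$; (v) $x|x'$ is a single element of $P$ and $x|x'=y|y'$; (vi) $(x|x')'|x=x|x'$; (vii) $z\in x|y$ if and only if [$z'|x=z'|y=z$, and for every $u\in P$ with $u'|x=u'|y=u$ and $z'|u'=z$ we have $z=u$]. That is, $(P,|)$ is a Sheffer structure.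
   Context: ACC/DCC: no infinite strictly ascending/descending chains. For $X\subseteq P$: $L(X)$ is the set of lower bounds of $X$, $U(X)$ the set of upper bounds, $\operatorname{Max}$, $\operatorname{Min}$ the sets of maximal/minimal elements, $\operatorname{Max}L(x,y)=\operatorname{Max}(L(\{x,y\}))$. A complemented poset is a bounded poset $(P,\le,{}',0,1)$ with an antitone involution $'$ (i.e. $x\le y\Rightarrow y'\le x'$, $x''=x$) such that $L(x,x')=\{0\}$ and $U(x,x')=\{1\}$ for all $x$. In the displayed conditions a prime applied to a subset means elementwise complement. *)

theory Defs
  imports Main
begin

definition lower_bounds :: "'a::order set \<Rightarrow> 'a set" where
  "lower_bounds X = {l. \<forall>x\<in>X. l \<le> x}"

definition upper_bounds :: "'a::order set \<Rightarrow> 'a set" where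
  "upper_bounds X = {u. \<forall>x\<in>X. x \<le> u}"

definition maximals :: "'a::order set \<Rightarrow> 'a set" where
  "maximals X = {m \<in> X. \<not> (\<exists>x\<in>X. m < x)}"

locale complemented_poset =
  fixes compl :: "'a::{order_bot, order_top} \<Rightarrow> 'a"
  assumes antitone: "x \<le> y \<Longrightarrow> compl y \<le> compl x"
    and involution: "compl (compl x) = x"
    and lower_bounds_compl: "lower_bounds {x, compl x} = {bot}"
    and upper_bounds_compl: "upper_bounds {x, compl x} = {top}"

text \<open>The operation acts on subsets; an element x is passed as the singleton {x}
  (lemma \<open>sheffer_singletons\<close> recovers the operation on elements).\<close>

definition sheffer :: "('a::order \<Rightarrow> 'a) \<Rightarrow> 'a set \<Rightarrow> 'a set \<Rightarrow> 'a set" where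
  "sheffer compl A B = maximals (lower_bounds (compl ` A \<union> compl ` B))"

lemma sheffer_singletons:
  "sheffer compl {x} {y} = maximals (lower_bounds {compl x, compl y})"
  by (simp add: sheffer_def insert_commute)

end

theory Submission
  imports Defs
begin

text \<open>Up to complementation \<open>A | B\<close> is \<open>Max L(A, B)\<close>, and a set with a
  greatest element \<open>m\<close> has \<open>{m}\<close> as its set of maximal elements. Most identities follow
  by exhibiting this greatest element; in particular \<open>Max L(u, v) = {u}\<close> iff \<open>u \<le> v\<close>,
  so that (vii) expresses maximality among the lower bounds of \<open>x'\<close> and \<open>y'\<close>.
  Only (iv) needs a chain condition: by ACC the set \<open>Max L(y, z)\<close> is nonempty, hence every
  element of \<open>B = Max L(x, Max L(y, z))\<close> lies below \<open>z\<close>, and \<open>B\<close> itself is nonempty,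
  so that \<open>L(B, z) = L(B)\<close>.\<close>

lemma maximals_eq_singleton:
  assumes "m \<in> X" and "\<And>x. x \<in> X \<Longrightarrow> x \<le> m"
  shows "maximals X = {m}"
  using assms unfolding maximals_def by (auto simp: order_less_le dest: antisym)

text \<open>Without a maximal element, every member of \<open>X\<close> has a strictly larger one in
  \<open>X\<close>, and dependent choice strings these into an infinite ascending chain.\<close>

lemma maximals_nonempty:
  fixes X :: "'a::order set"
  assumes ACC: "\<not> (\<exists>f :: nat \<Rightarrow> 'a. \<forall>n. f n < f (Suc n))" and "X \<noteq> {}"
  shows "maximals X \<noteq> {}"
proof
  assume "maximals X = {}"
  then have "\<exists>y. y \<in> X \<and> x < y" if "x \<in> X" for x
    using that by (auto simp: maximals_def)
  then have "\<exists>f. \<forall>n::nat. f n \<in> X \<and> f n < f (Suc n)"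
    using \<open>X \<noteq> {}\<close> by (intro dependent_nat_choice) auto
  with ACC show False by blast
qed

lemma bot_in_lower_bounds: "(bot :: 'a::order_bot) \<in> lower_bounds X"
  by (simp add: lower_bounds_def)

lemma lower_bounds_insert_redundant:
  assumes "b \<in> B" "b \<le> z"
  shows "lower_bounds (insert z B) = lower_bounds B"
  using assms order_trans[OF _ \<open>b \<le> z\<close>] unfolding lower_bounds_def by blast

lemma maximals_lower_bounds_pair_iff:
  "maximals (lower_bounds {u, v}) = {u} \<longleftrightarrow> u \<le> v"
proof
  assume "maximals (lower_bounds {u, v}) = {u}"
  then have "u \<in> maximals (lower_bounds {u, v})" by simp
  then show "u \<le> v" by (simp add: maximals_def lower_bounds_def)
next
  assume "u \<le> v"
  then show "maximals (lower_bounds {u, v}) = {u}"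
    by (intro maximals_eq_singleton) (auto simp: lower_bounds_def)
qed

context complemented_poset
begin

lemma compl_bot: "compl bot = top"
  by (metis antitone bot_least involution top_unique)

lemma compl_image_image: "compl ` compl ` A = A"
  by (simp add: image_image involution)

lemma sheffer_commute: "sheffer compl A B = sheffer compl B A"
  by (simp add: sheffer_def Un_commute)

lemma sheffer_idem: "sheffer compl {x} {x} = {compl x}"
  using maximals_lower_bounds_pair_iff[of "compl x" "compl x"]
  by (simp add: sheffer_singletons)

lemma sheffer_compl_self: "sheffer compl {x} {compl x} = {bot}"
  using lower_bounds_compl[of "compl x"]
  by (simp add: sheffer_singletons maximals_def)

lemma sheffer_compl_eq_iff: "sheffer compl {compl z} {x} = {z} \<longleftrightarrow> z \<le> compl x"
  by (simp add: sheffer_singletons involution maximals_lower_bounds_pair_iff)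

text \<open>Each element of \<open>x | y\<close> lies below \<open>x'\<close>, so its complement
  lies above \<open>x\<close>. Hence \<open>x\<close> is the greatest lower bound of these
  complements together with \<open>x'' = x\<close>.\<close>

lemma sheffer_absorb: "sheffer compl (sheffer compl {x} {y}) (sheffer compl {x} {x}) = {x}"
  unfolding sheffer_idem unfolding sheffer_def
proof (rule maximals_eq_singleton)
  have "x \<le> compl m" if "m \<le> compl x" for m
    using antitone[OF that] by (simp add: involution)
  then show "x \<in> lower_bounds (compl ` maximals (lower_bounds (compl ` {x} \<union> compl ` {y}))
      \<union> compl ` {compl x})"
    by (auto simp: lower_bounds_def maximals_def involution)
qed (simp add: lower_bounds_def involution)

lemma sheffer_top: "sheffer compl {top} A = {bot}"
  unfolding sheffer_def
  \<comment> \<open>Writing \<open>top\<close> as \<open>compl bot\<close> makes its complement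
    \<open>bot\<close>, which forces every lower bound down to \<open>bot\<close>.\<close>
  by (rule maximals_eq_singleton)
    (auto simp: lower_bounds_def compl_bot[symmetric] involution)

text \<open>Both sides reduce to \<open>Max L(B)\<close>: on the left \<open>z\<close>, on the right
  \<open>bot' = top\<close> lies above some element of \<open>B\<close> and is therefore
  redundant.\<close>

lemma sheffer_nested:
  assumes ACC: "\<not> (\<exists>f :: nat \<Rightarrow> 'a. \<forall>n. f n < f (Suc n))"
  defines "B X Y Z \<equiv> sheffer compl {compl X} (compl ` sheffer compl {compl Y} {compl Z})"
  shows "sheffer compl (compl ` B x y z) {compl z} = sheffer compl (compl ` B x y z) {bot}"
proof -
  let ?M = "maximals (lower_bounds {y, z})"
  have B: "B x y z = maximals (lower_bounds (insert x ?M))"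
    by (simp add: B_def sheffer_singletons sheffer_def compl_image_image involution
        insert_commute)
  have nonempty: "maximals (lower_bounds X) \<noteq> {}" for X :: "'a set"
    using bot_in_lower_bounds by (intro maximals_nonempty[OF ACC]) blast
  obtain m where m: "m \<in> ?M" using nonempty by blast
  obtain b where b: "b \<in> B x y z" using nonempty B by blast
  have "b \<le> m" using b m by (simp add: B maximals_def lower_bounds_def)
  also have "m \<le> z" using m by (simp add: maximals_def lower_bounds_def)
  finally have "b \<le> z" .
  then show ?thesis
    using b by (simp add: sheffer_def compl_image_image involution compl_bot
        lower_bounds_insert_redundant)
qed

text \<open>The equations for \<open>z\<close> and \<open>u\<close> say that both are lower bounds
  of \<open>x'\<close> and \<open>y'\<close>. The one joining them says
  \<open>z \<le> u'' = u\<close>, so the last clause forbids a lower bound strictly above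
  \<open>z\<close>.\<close>

lemma mem_sheffer_iff:
  "z \<in> sheffer compl {x} {y} \<longleftrightarrow>
    sheffer compl {compl z} {x} = {z} \<and> sheffer compl {compl z} {y} = {z} \<and>
    (\<forall>u. sheffer compl {compl u} {x} = {u} \<and> sheffer compl {compl u} {y} = {u}
      \<and> sheffer compl {compl z} {compl u} = {z} \<longrightarrow> z = u)"
  unfolding sheffer_compl_eq_iff involution
  by (auto simp: sheffer_singletons maximals_def lower_bounds_def order_less_le)

end

theorem theorem4p6:
  fixes c :: "'a::{order_bot, order_top} \<Rightarrow> 'a"
    and S :: "'a set \<Rightarrow> 'a set \<Rightarrow> 'a set" (infixl "\<bar>\<bar>" 70)
  assumes compl: "complemented_poset c"
    and ACC: "\<not> (\<exists>f :: nat \<Rightarrow> 'a. \<forall>n. f n < f (Suc n))"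
    and DCC: "\<not> (\<exists>f :: nat \<Rightarrow> 'a. \<forall>n. f (Suc n) < f n)"
  defines "S \<equiv> sheffer c"
  shows "\<forall>x y z.
      {x} \<bar>\<bar> {y} = {y} \<bar>\<bar> {x}
    \<and> ({x} \<bar>\<bar> {x}) \<bar>\<bar> ({x} \<bar>\<bar> {x}) = {x}
    \<and> ({x} \<bar>\<bar> {y}) \<bar>\<bar> ({x} \<bar>\<bar> {x}) = {x}
    \<and> (c ` ({c x} \<bar>\<bar> (c ` ({c y} \<bar>\<bar> {c z})))) \<bar>\<bar> {c z}
        = (c ` ({c x} \<bar>\<bar> (c ` ({c y} \<bar>\<bar> {c z})))) \<bar>\<bar> ({x} \<bar>\<bar> {c x})
    \<and> ((\<exists>e. {x} \<bar>\<bar> {c x} = {e}) \<and> {x} \<bar>\<bar> {c x} = {y} \<bar>\<bar> {c y})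
    \<and> (c ` ({x} \<bar>\<bar> {c x})) \<bar>\<bar> {x} = {x} \<bar>\<bar> {c x}
    \<and> (z \<in> {x} \<bar>\<bar> {y} \<longleftrightarrow>
          ({c z} \<bar>\<bar> {x} = {z} \<and> {c z} \<bar>\<bar> {y} = {z} \<and>
           (\<forall>u. {c u} \<bar>\<bar> {x} = {u} \<and> {c u} \<bar>\<bar> {y} = {u} \<and> {c z} \<bar>\<bar> {c u} = {z}
                \<longrightarrow> z = u)))"
proof -
  interpret complemented_poset c by (fact compl)
  show ?thesis
    unfolding S_def
    \<comment> \<open>Identity (ii) is absorption with \<open>y = x\<close>. In (iv)-(vi),
      \<open>x | x'\<close> becomes \<open>{bot}\<close>; (vi) then reads
      \<open>top | x = bot\<close>.\<close>
    by (intro allI conjI sheffer_commute sheffer_absorb mem_sheffer_iff)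
      (simp_all add: sheffer_idem involution sheffer_compl_self compl_bot sheffer_top
        sheffer_nested[OF ACC])
qed

end
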